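(* Let $s\ge 1$ be an integer, let $0=c_0<c_1<\cdots<c_s=1$, and let $a_{ij},\widehat a_{ij}\in\mathbb R$ ($1\le i\le s$, $0\le j\le s$) be coefficients satisfying the Hermite moment conditions $$\sum_{j=0}^s a_{ij}c_j^{m-1}+(m-1)\sum_{j=0}^s\widehat a_{ij}c_j^{m-2}=\frac{c_i^m}{m},\qquad m=1,\ldots,2s,\quad i=1,\ldots,s$$ (for $m=1$ the second sum is understood to be zero). Let $u$ be an exact solution of $u_t=\mathcal L(u)$ having $2s+1$ bounded time derivatives on the step $[t_n,t_n+\Delta t]$. Then the stage defects $$d_i=u(t_n+c_i\Delta t)-u(t_n)-\Delta t\sum_{j=0}^s a_{ij}\,u'(t_n+c_j\Delta t)-\Delta t^2\sum_{j=0}^s\widehat a_{ij}\,u''(t_n+c_j\Delta t)$$ satisfy $$d_i=\mathcal O(\Delta t^{2s+1}),\qquad i=1,\ldots,s.$$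
   Context: The initial-value problem is $u_t=\mathcal L(u)$, $u(t_0)=u_0$, $u(t)\in\mathbb R^d$, with $\mathcal L:\mathbb R^d\to\mathbb R^d$ sufficiently smooth. The first total time derivative of the vector field is $\dot{\mathcal L}(u)=\mathcal L_u(u)\mathcal L(u)$, so that along an exact solution $\mathcal L(u(t))=u'(t)$ and $\dot{\mathcal L}(u(t))=u''(t)$. The defect $d_i$ is the residual obtained by inserting the exact values $u(t_n+c_j\Delta t)$ into the $i$th stage equation $Y_i=Y_0+\Delta t\sum_{j=0}^s a_{ij}\mathcal L(Y_j)+\Delta t^2\sum_{j=0}^s\widehat a_{ij}\dot{\mathcal L}(Y_j)$. The notation $\mathcal O(\Delta t^{2s+1})$ is as $\Delta t\to 0$, with constant depending on the coefficients and on the bounds for the derivatives of $u$, but not on $\Delta t$. The convention $0^0=1$ is used for powers of $c_0=0$. *)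

theory Defs
  imports "HOL-Analysis.Analysis"
begin

text \<open>
  The derivatives are taken within the closed interval \<open>S\<close>, hence they are one-sided at its
  endpoints: a solution need not be defined outside the current step.
\<close>

definition time_deriv :: "real set \<Rightarrow> nat \<Rightarrow> (real \<Rightarrow> 'a::real_normed_vector) \<Rightarrow> real \<Rightarrow> 'a" where
  "time_deriv S k u = ((\<lambda>f t. vector_derivative f (at t within S)) ^^ k) u"

definition bounded_time_derivs ::
    "real set \<Rightarrow> nat \<Rightarrow> (nat \<Rightarrow> real) \<Rightarrow> (real \<Rightarrow> 'a::real_normed_vector) \<Rightarrow> bool" where
  "bounded_time_derivs S p B u \<longleftrightarrow>
     (\<forall>k<p. \<forall>t\<in>S. time_deriv S k u differentiable (at t within S)) \<and>
     (\<forall>k\<in>{1..p}. \<forall>t\<in>S. norm (time_deriv S k u t) \<le> B k)"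

text \<open>
  The least smoothness for which the total time derivative of the field is continuous; the
  regularity of a solution is prescribed separately by \<open>bounded_time_derivs\<close>.
\<close>

definition C1_field :: "('a::real_normed_vector \<Rightarrow> 'a) \<Rightarrow> bool" where
  "C1_field L \<longleftrightarrow>
     (\<exists>L' :: 'a \<Rightarrow> 'a \<Rightarrow>\<^sub>L 'a.
        (\<forall>x. (L has_derivative blinfun_apply (L' x)) (at x)) \<and> continuous_on UNIV L')"

definition exact_solution ::
    "('a::real_normed_vector \<Rightarrow> 'a) \<Rightarrow> real set \<Rightarrow> (real \<Rightarrow> 'a) \<Rightarrow> bool" where
  "exact_solution L S u \<longleftrightarrow> (\<forall>t\<in>S. (u has_vector_derivative L (u t)) (at t within S))"

text \<open>
  For \<open>m = 1\<close> the exponent \<open>m - 2\<close> is truncated, but then the factor \<open>real (m - 1)\<close> is zero.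
\<close>

definition hermite_moments ::
    "nat \<Rightarrow> (nat \<Rightarrow> real) \<Rightarrow> (nat \<Rightarrow> nat \<Rightarrow> real) \<Rightarrow> (nat \<Rightarrow> nat \<Rightarrow> real) \<Rightarrow> bool" where
  "hermite_moments s c a ahat \<longleftrightarrow>
     (\<forall>m\<in>{1..2 * s}. \<forall>i\<in>{1..s}.
        (\<Sum>j=0..s. a i j * c j ^ (m - 1)) + real (m - 1) * (\<Sum>j=0..s. ahat i j * c j ^ (m - 2))
          = c i ^ m / real m)"

definition stage_defect ::
    "nat \<Rightarrow> (nat \<Rightarrow> real) \<Rightarrow> (nat \<Rightarrow> nat \<Rightarrow> real) \<Rightarrow> (nat \<Rightarrow> nat \<Rightarrow> real)
      \<Rightarrow> real \<Rightarrow> real \<Rightarrow> (real \<Rightarrow> 'a::real_normed_vector) \<Rightarrow> nat \<Rightarrow> 'a" where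
  "stage_defect s c a ahat tn \<Delta>t u i =
     u (tn + c i * \<Delta>t) - u tn
     - \<Delta>t *\<^sub>R (\<Sum>j=0..s. a i j *\<^sub>R time_deriv {tn..tn + \<Delta>t} 1 u (tn + c j * \<Delta>t))
     - \<Delta>t\<^sup>2 *\<^sub>R (\<Sum>j=0..s. ahat i j *\<^sub>R time_deriv {tn..tn + \<Delta>t} 2 u (tn + c j * \<Delta>t))"

text \<open>
  The total time derivative of the vector field. Along an exact solution, the field and its total
  derivative are the first two time derivatives of the solution, so \<open>stage_defect\<close> is the
  residual of the exact values in the stage equation.
\<close>

definition total_deriv :: "('a::real_normed_vector \<Rightarrow> 'a) \<Rightarrow> 'a \<Rightarrow> 'a" where
  "total_deriv L x = frechet_derivative L (at x) (L x)"

lemma time_deriv_exact_solution: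
  assumes L: "C1_field L" and u: "exact_solution L {a..b} u" and "a < b" and t: "t \<in> {a..b}"
  shows "time_deriv {a..b} 1 u t = L (u t)"
    and "time_deriv {a..b} 2 u t = total_deriv L (u t)"
proof -
  have 1: "time_deriv {a..b} 1 u r = L (u r)" if "r \<in> {a..b}" for r
    using u that \<open>a < b\<close> vector_derivative_within_cbox[of a b r u "L (u r)"]
    by (simp add: time_deriv_def exact_solution_def)
  then show "time_deriv {a..b} 1 u t = L (u t)" using t .
  have "(L has_derivative frechet_derivative L (at (u t))) (at (u t))"
    using L unfolding C1_field_def by (metis differentiableI frechet_derivative_works)
  then have "((\<lambda>r. L (u r)) has_vector_derivative total_deriv L (u t)) (at t within {a..b})"
    using u t vector_derivative_diff_chain_within[of u "L (u t)" t "{a..b}" L "frechet_derivative L (at (u t))"]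
    by (auto simp: exact_solution_def total_deriv_def o_def intro: has_derivative_at_withinI)
  then have "(time_deriv {a..b} 1 u has_vector_derivative total_deriv L (u t)) (at t within {a..b})"
    using t 1 by (rule has_vector_derivative_transform[rotated 2]) auto
  then show "time_deriv {a..b} 2 u t = total_deriv L (u t)"
    using t \<open>a < b\<close> vector_derivative_within_cbox[of a b t]
    by (simp add: time_deriv_def numeral_2_eq_2)
qed

end

theory Submission imports Defs begin

text \<open>
  Expand \<open>u\<close>, \<open>u'\<close> and \<open>u''\<close> at \<open>t\<^sub>n\<close> by Taylor's theorem, up to remainders bounded by the
  derivative of order \<open>2 s + 1\<close>. In the defect, the coefficient of the derivative of order \<open>m\<close>
  is \<open>\<Delta>t ^ m / (m - 1)!\<close> times the residual of the \<open>m\<close>-th Hermite moment condition, hence zero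
  for \<open>1 \<le> m \<le> 2 s\<close>, and only the remainders are left.
\<close>

lemma has_vector_derivative_time_deriv:
  assumes "bounded_time_derivs S p B u" "k < p" "t \<in> S"
  shows "(time_deriv S k u has_vector_derivative time_deriv S (Suc k) u t) (at t within S)"
  using assms unfolding bounded_time_derivs_def
  by (auto simp: time_deriv_def vector_derivative_works)

text \<open>The integral form of the remainder is used because the values are vectors, for which the
  mean value form fails. The integral is the gauge integral, so existence of the derivative of order
  \<open>p\<close> is enough for the formula, without continuity of it.\<close>

lemma time_deriv_taylor_bound:
  fixes u :: "real \<Rightarrow> 'a::banach"
  assumes u: "bounded_time_derivs {a..b} p B u" and "k < p" and t: "t \<in> {a..b}"
  shows "norm (time_deriv {a..b} k u t
                - (\<Sum>m=k..<p. ((t - a) ^ (m - k) / fact (m - k)) *\<^sub>R time_deriv {a..b} m u a))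
           \<le> B p * (t - a) ^ (p - k)"
proof -
  let ?D = "\<lambda>m. time_deriv {a..b} (k + m) u"
  let ?f = "\<lambda>x. ((t - x) ^ (p - k - 1) / fact (p - k - 1)) *\<^sub>R ?D (p - k) x"
  have B: "norm (time_deriv {a..b} p u x) \<le> B p" if "x \<in> {a..b}" for x
    using u \<open>k < p\<close> that by (auto simp: bounded_time_derivs_def)
  have B0: "0 \<le> B p"
    using B[OF t] norm_ge_zero order_trans by blast
  \<comment> \<open>Only the filter shrinks to \<open>{a..t}\<close>, the interval of integration;
    the functions \<open>?D m\<close> remain derivatives relative to \<open>{a..b}\<close>.\<close>
  have D: "(?D m has_vector_derivative ?D (Suc m) x) (at x within {a..t})"
    if "m < p - k" "a \<le> x" "x \<le> t" for m x
  proof -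
    have "(?D m has_vector_derivative ?D (Suc m) x) (at x within {a..b})"
      using has_vector_derivative_time_deriv[OF u, of "k + m" x] that t by simp
    then show ?thesis
      using t by (auto intro: has_vector_derivative_within_subset)
  qed
  have "(?f has_integral ?D 0 t - (\<Sum>m<p - k. ((t - a) ^ m / fact m) *\<^sub>R ?D m a)) {a..t}"
    using Taylor_has_integral[of "p - k" ?D "?D 0" a t] D \<open>k < p\<close> t by auto
  \<comment> \<open>Indexing by the absolute order of the derivative lets the expansions for
    \<open>k = 0, 1, 2\<close> be compared term by term later.\<close>
  moreover have "(\<Sum>m<p - k. ((t - a) ^ m / fact m) *\<^sub>R ?D m a)
      = (\<Sum>m=k..<p. ((t - a) ^ (m - k) / fact (m - k)) *\<^sub>R time_deriv {a..b} m u a)"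
    by (rule sum.reindex_bij_witness[of _ "\<lambda>m. m - k" "\<lambda>m. k + m"]) auto
  moreover have "norm (?f x) \<le> (t - a) ^ (p - k - 1) * B p" if "x \<in> {a..t}" for x
  proof -
    have "(t - x) ^ (p - k - 1) / fact (p - k - 1) \<le> (t - x) ^ (p - k - 1) / 1"
      using that by (intro divide_left_mono) auto
    also have "\<dots> \<le> (t - a) ^ (p - k - 1)"
      using that by (auto intro: power_mono)
    finally have "(t - x) ^ (p - k - 1) / fact (p - k - 1) \<le> (t - a) ^ (p - k - 1)" .
    moreover have "norm (?D (p - k) x) \<le> B p"
      using B[of x] that t \<open>k < p\<close> by auto
    moreover have "norm (?f x) = (t - x) ^ (p - k - 1) / fact (p - k - 1) * norm (?D (p - k) x)"
      using that by simp
    ultimately show ?thesis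
      using that B0 by (simp only:) (intro mult_mono; auto)
  qed
  \<comment> \<open>The length \<open>t - a\<close> of the interval supplies the last power; the
    factorial has been estimated crudely by 1.\<close>
  ultimately have "norm (time_deriv {a..b} k u t
      - (\<Sum>m=k..<p. ((t - a) ^ (m - k) / fact (m - k)) *\<^sub>R time_deriv {a..b} m u a))
      \<le> ((t - a) ^ (p - k - 1) * B p) * (t - a)"
    using has_integral_bound_real[of "(t - a) ^ (p - k - 1) * B p" "{}" ?f _ a t] B0 t
    by auto
  moreover have "(t - a) ^ (p - k) = (t - a) ^ (p - k - 1) * (t - a)"
    using \<open>k < p\<close> by (simp add: Suc_diff_Suc flip: power_Suc2)
  ultimately show ?thesis
    by (simp add: mult_ac)
qed

text \<open>This is the moment condition divided by \<open>(m - 1)!\<close>, using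
  \<open>m! = m * (m - 1)!\<close> and \<open>(m - 1) / (m - 1)! = 1 / (m - 2)!\<close>. The case
  distinction reflects that the expansion of the second derivative has no term of order 1.\<close>

lemma hermite_moments_taylor_coeff:
  assumes "hermite_moments s c a ahat" "m \<in> {1..2 * s}" "i \<in> {1..s}"
  shows "(\<Sum>j=0..s. a i j * (c j ^ (m - 1) / fact (m - 1)))
      + (if 2 \<le> m then \<Sum>j=0..s. ahat i j * (c j ^ (m - 2) / fact (m - 2)) else 0)
      = c i ^ m / fact m"
proof -
  have e: "(\<Sum>j=0..s. a i j * c j ^ (m - 1)) + real (m - 1) * (\<Sum>j=0..s. ahat i j * c j ^ (m - 2))
          = c i ^ m / real m"
    using assms unfolding hermite_moments_def by blast
  have f: "fact m = real m * fact (m - 1)"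
    using assms by (simp add: fact_reduce)
  have g: "fact (m - 1) = real (m - 1) * fact (m - 2)" if "2 \<le> m"
    using that fact_reduce[of "m - 1", where ?'a = real] by (simp add: numeral_2_eq_2)
  have "c i ^ m / fact m = (c i ^ m / real m) / fact (m - 1)"
    by (simp add: f)
  also have "\<dots> = (\<Sum>j=0..s. a i j * c j ^ (m - 1)) / fact (m - 1)
      + real (m - 1) / fact (m - 1) * (\<Sum>j=0..s. ahat i j * c j ^ (m - 2))"
    by (simp only: e[symmetric] add_divide_distrib times_divide_eq_left)
  also have "real (m - 1) / fact (m - 1) = (if 2 \<le> m then 1 / fact (m - 2) else 0)"
  proof (cases "2 \<le> m")
    case True
    then have "real (m - 1) \<noteq> 0"
      by simp
    from nonzero_divide_mult_cancel_left[OF this, of "fact (m - 2)"] True show ?thesis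
      by (simp only: g[OF True] if_True)
  next
    case False
    then have "m = 1"
      using assms(2) by auto
    then show ?thesis
      by simp
  qed
  finally show ?thesis
    by (simp add: sum_divide_distrib)
qed

text \<open>The defect is linear in the data \<open>u\<close>, \<open>u'\<close>,
  \<open>u''\<close>, and it vanishes on their Taylor polynomials by the moment conditions. The
  identity is purely algebraic: the derivatives at \<open>tn\<close> enter only as vectors.\<close>

lemma stage_defect_eq_remainders:
  fixes u :: "real \<Rightarrow> 'a::real_normed_vector" and s :: nat and tn h :: real
  defines "R \<equiv> \<lambda>k t. time_deriv {tn..tn + h} k u t
      - (\<Sum>m=k..<2 * s + 1. ((t - tn) ^ (m - k) / fact (m - k)) *\<^sub>R time_deriv {tn..tn + h} m u tn)"
  assumes "hermite_moments s c a ahat" "i \<in> {1..s}"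
  shows "stage_defect s c a ahat tn h u i = R 0 (tn + c i * h)
      - h *\<^sub>R (\<Sum>j=0..s. a i j *\<^sub>R R 1 (tn + c j * h))
      - h\<^sup>2 *\<^sub>R (\<Sum>j=0..s. ahat i j *\<^sub>R R 2 (tn + c j * h))"
proof -
  let ?D = "\<lambda>m. time_deriv {tn..tn + h} m u tn"
  define M where "M = {1..<2 * s + 1}"
  let ?T = "\<lambda>k \<theta>. \<Sum>m=k..<2 * s + 1. ((\<theta> * h) ^ (m - k) / fact (m - k)) *\<^sub>R ?D m"
  \<comment> \<open>The term of order 0 is split off, to cancel against the \<open>u tn\<close> in
    the defect; all other terms are collected over the common index set \<open>M\<close>.\<close>
  have T0: "?T 0 \<theta> = u tn + (\<Sum>m\<in>M. (h ^ m * (\<theta> ^ m / fact m)) *\<^sub>R ?D m)" for \<theta>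
    by (simp add: M_def sum.atLeast_Suc_lessThan[of 0] time_deriv_def power_mult_distrib mult_ac
        del: sum.op_ivl_Suc)
  have T1: "h *\<^sub>R (\<Sum>j=0..s. a i j *\<^sub>R ?T 1 (c j))
      = (\<Sum>m\<in>M. (h ^ m * (\<Sum>j=0..s. a i j * (c j ^ (m - 1) / fact (m - 1)))) *\<^sub>R ?D m)"
  proof -
    have "h *\<^sub>R (\<Sum>j=0..s. a i j *\<^sub>R ?T 1 (c j))
        = (\<Sum>j=0..s. \<Sum>m\<in>M. (h * a i j * ((c j * h) ^ (m - 1) / fact (m - 1))) *\<^sub>R ?D m)"
      by (simp add: M_def scaleR_sum_right mult_ac del: sum.op_ivl_Suc)
    also have "\<dots> = (\<Sum>m\<in>M. \<Sum>j=0..s. (h * a i j * ((c j * h) ^ (m - 1) / fact (m - 1))) *\<^sub>R ?D m)"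
      by (rule sum.swap)
    also have "\<dots> = (\<Sum>m\<in>M. (\<Sum>j=0..s. h * a i j * ((c j * h) ^ (m - 1) / fact (m - 1))) *\<^sub>R ?D m)"
      by (simp add: scaleR_sum_left)
    also have "\<dots> = (\<Sum>m\<in>M. (h ^ m * (\<Sum>j=0..s. a i j * (c j ^ (m - 1) / fact (m - 1)))) *\<^sub>R ?D m)"
    proof (rule sum.cong[OF refl])
      fix m assume "m \<in> M"
      then have "h ^ m = h * h ^ (m - 1)"
        by (simp add: M_def flip: power_Suc)
      then show "(\<Sum>j=0..s. h * a i j * ((c j * h) ^ (m - 1) / fact (m - 1))) *\<^sub>R ?D m
          = (h ^ m * (\<Sum>j=0..s. a i j * (c j ^ (m - 1) / fact (m - 1)))) *\<^sub>R ?D m"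
        by (simp add: sum_distrib_left power_mult_distrib mult_ac)
    qed
    finally show ?thesis .
  qed
  have T2: "h\<^sup>2 *\<^sub>R (\<Sum>j=0..s. ahat i j *\<^sub>R ?T 2 (c j))
      = (\<Sum>m\<in>M. (h ^ m * (if 2 \<le> m then \<Sum>j=0..s. ahat i j * (c j ^ (m - 2) / fact (m - 2)) else 0)) *\<^sub>R ?D m)"
  proof -
    let ?N = "{2..<2 * s + 1}"
    have "h\<^sup>2 *\<^sub>R (\<Sum>j=0..s. ahat i j *\<^sub>R ?T 2 (c j))
        = (\<Sum>j=0..s. \<Sum>m\<in>?N. (h\<^sup>2 * ahat i j * ((c j * h) ^ (m - 2) / fact (m - 2))) *\<^sub>R ?D m)"
      by (simp add: scaleR_sum_right mult_ac del: sum.op_ivl_Suc)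
    also have "\<dots> = (\<Sum>m\<in>?N. \<Sum>j=0..s. (h\<^sup>2 * ahat i j * ((c j * h) ^ (m - 2) / fact (m - 2))) *\<^sub>R ?D m)"
      by (rule sum.swap)
    also have "\<dots> = (\<Sum>m\<in>?N. (\<Sum>j=0..s. h\<^sup>2 * ahat i j * ((c j * h) ^ (m - 2) / fact (m - 2))) *\<^sub>R ?D m)"
      by (simp add: scaleR_sum_left)
    also have "\<dots> = (\<Sum>m\<in>M. (h ^ m * (if 2 \<le> m then \<Sum>j=0..s. ahat i j * (c j ^ (m - 2) / fact (m - 2)) else 0)) *\<^sub>R ?D m)"
    \<comment> \<open>The orders start at 2 here; the zero branch of the conditional pads the sum
      with the order 1, so that it also runs over \<open>M\<close>.\<close>
    proof (rule sum.mono_neutral_cong_left)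
      fix m assume m: "m \<in> ?N"
      then have "2 + (m - 2) = m"
        by auto
      then have hm: "h ^ m = h\<^sup>2 * h ^ (m - 2)"
        using power_add[of h 2 "m - 2"] by (simp only:)
      have "(\<Sum>j=0..s. h\<^sup>2 * ahat i j * ((c j * h) ^ (m - 2) / fact (m - 2)))
          = h\<^sup>2 * h ^ (m - 2) * (\<Sum>j=0..s. ahat i j * (c j ^ (m - 2) / fact (m - 2)))"
        unfolding sum_distrib_left
        by (rule sum.cong[OF refl]) (simp add: power_mult_distrib)
      then show "(\<Sum>j=0..s. h\<^sup>2 * ahat i j * ((c j * h) ^ (m - 2) / fact (m - 2))) *\<^sub>R ?D m
          = (h ^ m * (if 2 \<le> m then \<Sum>j=0..s. ahat i j * (c j ^ (m - 2) / fact (m - 2)) else 0)) *\<^sub>R ?D m"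
        using m by (simp only: hm atLeastLessThan_iff if_True)
    qed (auto simp: M_def)
    finally show ?thesis .
  qed
  have "h *\<^sub>R (\<Sum>j=0..s. a i j *\<^sub>R ?T 1 (c j)) + h\<^sup>2 *\<^sub>R (\<Sum>j=0..s. ahat i j *\<^sub>R ?T 2 (c j))
      = (\<Sum>m\<in>M. (h ^ m * (c i ^ m / fact m)) *\<^sub>R ?D m)"
    unfolding T1 T2 sum.distrib[symmetric]
  proof (rule sum.cong[OF refl])
    fix m assume "m \<in> M"
    then have "m \<in> {1..2 * s}"
      by (auto simp: M_def)
    from hermite_moments_taylor_coeff[OF assms(2) this assms(3), symmetric]
    show "(h ^ m * (\<Sum>j=0..s. a i j * (c j ^ (m - 1) / fact (m - 1)))) *\<^sub>R ?D m
        + (h ^ m * (if 2 \<le> m then \<Sum>j=0..s. ahat i j * (c j ^ (m - 2) / fact (m - 2)) else 0)) *\<^sub>R ?D m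
        = (h ^ m * (c i ^ m / fact m)) *\<^sub>R ?D m"
      by (simp only: scaleR_add_left distrib_left)
  qed
  then have poly: "?T 0 (c i) = u tn + h *\<^sub>R (\<Sum>j=0..s. a i j *\<^sub>R ?T 1 (c j))
      + h\<^sup>2 *\<^sub>R (\<Sum>j=0..s. ahat i j *\<^sub>R ?T 2 (c j))"
    unfolding T0 by (simp only: add.assoc)
  have R: "R k (tn + \<theta> * h) = time_deriv {tn..tn + h} k u (tn + \<theta> * h) - ?T k \<theta>" for k \<theta>
    by (simp only: R_def add_diff_cancel_left')
  have u: "time_deriv {tn..tn + h} 0 u t = u t" for t
    by (simp add: time_deriv_def)
  \<comment> \<open>Here \<open>P\<close> and \<open>Q\<close> stand for the polynomial parts of
    \<open>p\<close> and \<open>q\<close>; by \<open>poly\<close>, \<open>y + P + Q\<close> is the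
    polynomial part of \<open>x\<close>.\<close>
  have split: "x - y - p - q = x - (y + P + Q) - (p - P) - (q - Q)" for x y p q P Q :: 'a
    by simp
  show ?thesis
    unfolding stage_defect_def R scaleR_diff_right sum_subtractf poly u
    by (rule split)
qed

theorem theorem3p1:
  fixes s :: nat
    and c :: "nat \<Rightarrow> real"
    and a ahat :: "nat \<Rightarrow> nat \<Rightarrow> real"
    and B :: "nat \<Rightarrow> real"
  assumes "s \<ge> 1"
    and "c 0 = 0" and "c s = 1" and "strict_mono_on {0..s} c"
    and "hermite_moments s c a ahat"
  shows "\<exists>K. \<forall>(L :: real ^ 'd \<Rightarrow> real ^ 'd) (u :: real \<Rightarrow> real ^ 'd) tn \<Delta>t.
           \<Delta>t > 0 \<longrightarrow> C1_field L \<longrightarrow> exact_solution L {tn..tn + \<Delta>t} u \<longrightarrow>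
           bounded_time_derivs {tn..tn + \<Delta>t} (2 * s + 1) B u \<longrightarrow>
           (\<forall>i\<in>{1..s}. norm (stage_defect s c a ahat tn \<Delta>t u i) \<le> K * \<Delta>t ^ (2 * s + 1))"
proof -
  let ?p = "2 * s + 1"
  \<comment> \<open>Summing over the stages gives one constant for all \<open>i\<close>, fixed
    before the field, the solution and the step. The absolute value of \<open>B ?p\<close> makes
    every summand nonnegative, whatever the sign of \<open>B ?p\<close>.\<close>
  define K where "K = (\<Sum>i=1..s. \<bar>B ?p\<bar> * (1 + (\<Sum>j=0..s. \<bar>a i j\<bar>) + (\<Sum>j=0..s. \<bar>ahat i j\<bar>)))"
  have c01: "0 \<le> c j \<and> c j \<le> 1" if "j \<in> {0..s}" for j
    using strict_mono_on_leD[OF assms(4), of 0 j] strict_mono_on_leD[OF assms(4), of j s]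
      that assms(2,3) by auto
  have "norm (stage_defect s c a ahat tn h u i) \<le> K * h ^ ?p"
    if "h > 0" and u: "bounded_time_derivs {tn..tn + h} ?p B u" and i: "i \<in> {1..s}"
    for u :: "real \<Rightarrow> real ^ 'd" and tn h i
  proof -
    define R where "R = (\<lambda>k t. time_deriv {tn..tn + h} k u t
      - (\<Sum>m=k..<?p. ((t - tn) ^ (m - k) / fact (m - k)) *\<^sub>R time_deriv {tn..tn + h} m u tn))"
    \<comment> \<open>Each differentiation costs the remainder one power of \<open>h\<close>, and
      the prefactor \<open>h ^ k\<close> in the defect restores it. Since the nodes lie in
      \<open>[0, 1]\<close>, the evaluation points stay within the step.\<close>
    have R: "norm (h ^ k *\<^sub>R R k (tn + c j * h)) \<le> \<bar>B ?p\<bar> * h ^ ?p"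
      if "k < ?p" "j \<in> {0..s}" for k j
    proof -
      have ch: "0 \<le> c j * h" "c j * h \<le> h"
        using c01[OF that(2)] \<open>h > 0\<close> by (auto simp: mult_left_le_one_le)
      then have "norm (R k (tn + c j * h)) \<le> B ?p * (c j * h) ^ (?p - k)"
        using time_deriv_taylor_bound[OF u that(1), of "tn + c j * h"]
        by (simp add: R_def del: sum.op_ivl_Suc)
      also have "\<dots> \<le> \<bar>B ?p\<bar> * h ^ (?p - k)"
        using ch by (intro mult_mono power_mono) auto
      finally have "h ^ k * norm (R k (tn + c j * h)) \<le> h ^ k * (\<bar>B ?p\<bar> * h ^ (?p - k))"
        using \<open>h > 0\<close> by (intro mult_left_mono) auto
      also have "\<dots> = \<bar>B ?p\<bar> * (h ^ k * h ^ (?p - k))"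
        by simp
      also have "h ^ k * h ^ (?p - k) = h ^ ?p"
        using that(1) by (simp flip: power_add)
      finally show ?thesis
        using \<open>h > 0\<close> by simp
    qed
    have S: "norm (h ^ k *\<^sub>R (\<Sum>j=0..s. w j *\<^sub>R R k (tn + c j * h)))
        \<le> (\<Sum>j=0..s. \<bar>w j\<bar>) * (\<bar>B ?p\<bar> * h ^ ?p)" if "k < ?p" for k and w :: "nat \<Rightarrow> real"
    proof -
      have "h ^ k *\<^sub>R (\<Sum>j=0..s. w j *\<^sub>R R k (tn + c j * h))
          = (\<Sum>j=0..s. w j *\<^sub>R h ^ k *\<^sub>R R k (tn + c j * h))"
        by (simp add: scaleR_sum_right mult_ac)
      also have "norm \<dots> \<le> (\<Sum>j=0..s. \<bar>w j\<bar> * (\<bar>B ?p\<bar> * h ^ ?p))"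
      proof (rule sum_norm_le)
        fix j assume "j \<in> {0..s}"
        from mult_left_mono[OF R[OF that this], of "\<bar>w j\<bar>"]
        show "norm (w j *\<^sub>R h ^ k *\<^sub>R R k (tn + c j * h)) \<le> \<bar>w j\<bar> * (\<bar>B ?p\<bar> * h ^ ?p)"
          by (simp add: abs_mult mult.assoc)
      qed
      finally show ?thesis
        by (simp add: sum_distrib_right)
    qed
    let ?X = "R 0 (tn + c i * h)"
    let ?Y = "h *\<^sub>R (\<Sum>j=0..s. a i j *\<^sub>R R 1 (tn + c j * h))"
    let ?Z = "h\<^sup>2 *\<^sub>R (\<Sum>j=0..s. ahat i j *\<^sub>R R 2 (tn + c j * h))"
    have "stage_defect s c a ahat tn h u i = ?X - ?Y - ?Z"
      unfolding R_def by (rule stage_defect_eq_remainders[OF assms(5) i])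
    moreover have "norm (?X - ?Y - ?Z) \<le> norm ?X + norm ?Y + norm ?Z"
      using norm_triangle_ineq4[of "?X - ?Y" ?Z] norm_triangle_ineq4[of ?X ?Y] by linarith
    moreover have "norm ?X \<le> \<bar>B ?p\<bar> * h ^ ?p"
      using R[of 0 i] i by simp
    \<comment> \<open>From \<open>s \<ge> 1\<close> both orders 1 and 2 lie below
      \<open>2 * s + 1\<close>, as the remainder estimate requires.\<close>
    moreover have "norm ?Y \<le> (\<Sum>j=0..s. \<bar>a i j\<bar>) * (\<bar>B ?p\<bar> * h ^ ?p)"
      using S[of 1 "a i"] assms(1) by simp
    moreover have "norm ?Z \<le> (\<Sum>j=0..s. \<bar>ahat i j\<bar>) * (\<bar>B ?p\<bar> * h ^ ?p)"
      using S[of 2 "ahat i"] assms(1) by simp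
    ultimately have "norm (stage_defect s c a ahat tn h u i)
        \<le> (\<bar>B ?p\<bar> * (1 + (\<Sum>j=0..s. \<bar>a i j\<bar>) + (\<Sum>j=0..s. \<bar>ahat i j\<bar>))) * h ^ ?p"
      by (simp only: distrib_left distrib_right mult_1_right mult_ac)
    \<comment> \<open>The left factor is the summand of index \<open>i\<close> in \<open>K\<close>,
      and the other summands are nonnegative.\<close>
    also have "\<dots> \<le> K * h ^ ?p"
      unfolding K_def using i \<open>h > 0\<close>
      by (intro mult_right_mono member_le_sum) (auto intro!: mult_nonneg_nonneg add_nonneg_nonneg sum_nonneg)
    finally show ?thesis .
  qed
  then show ?thesis
    by blast
qed

end
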